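(* Let $P$ be an Eulerian poset of rank at least $1$. If the $\mathbf{cd}$-index of $P$ has non-negative coefficients, then the $\mathbf{cd}$-index of the Tchebyshev transform $T(P)$ has non-negative coefficients; that is, $\Psi(P)\ge 0$ implies $\Psi(T(P))\ge 0$, where $\geq 0$ means that all coefficients, as a noncommutative polynomial in $\mathbf{c}$ and $\mathbf{d}$, are non-negative.
   Context: All graded posets are finite, with minimal element $\widehat{0}$, maximal element $\widehat{1}$ and rank function $\rho$; $\rho(x,y)=\rho(y)-\rho(x)$. A graded poset is Eulerian if every interval $[x,y]$ with $x<y$ has the same number of elements of even rank as of odd rank. For a graded poset $P$ of rank at least $1$, the weight of a chain $c=\{\widehat 0=x_0<x_1<\cdots<x_k=\widehat 1\}$ is $\mathrm{wt}(c)=(\mathbf{a}-\mathbf{b})^{\rho(x_0,x_1)-1}\cdot\mathbf{b}\cdot(\mathbf{a}-\mathbf{b})^{\rho(x_1,x_2)-1}\cdot\mathbf{b}\cdots\mathbf{b}\cdot(\mathbf{a}-\mathbf{b})^{\rho(x_{k-1},x_k)-1}$ in noncommuting variables $\mathbf{a},\mathbf{b}$, and the $\mathbf{ab}$-index is $\Psi(P)=\sum_c\mathrm{wt}(c)$ over all such chains. When $P$ is Eulerian, $\Psi(P)$ can be written uniquely as a noncommutative polynomial in $\mathbf{c}=\mathbf{a}+\mathbf{b}$ and $\mathbf{d}=\mathbf{a}\mathbf{b}+\mathbf{b}\mathbf{a}$, called the $\mathbf{cd}$-index of $P$. Tchebyshev transform: let $P\cup\{\widehat{-1}\}$ be $P$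 with a new minimal element $\widehat{-1}$ adjoined. $T(P)$ is the graded poset with elements $[x,y]$ for $x,y\in P\cup\{\widehat{-1}\}$, $x<y$, together with a maximal element $\widehat{1}_{T(P)}$, with cover relations: (i) $[x,y]\prec[y,w]$ if $y\prec w$; (ii) $[x,y]\prec[x,w]$ if $y\prec w$; (iii) $[x,\widehat 1]\prec\widehat{1}_{T(P)}$. By a theorem of Hetyei, $T(P)$ is Eulerian whenever $P$ is, so $T(P)$ has a $\mathbf{cd}$-index. *)

theory Defs
  imports "HOL-Library.Poly_Mapping"
begin

section \<open>Noncommutative polynomials\<close>

text \<open>
  Words over an alphabet form the free monoid under concatenation. With this instance the library
  makes the finitely supported functions from words to the integers a ring, with convolution as
  multiplication: the ring of noncommutative polynomials with integer coefficients.
\<close>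

instantiation list :: (type) monoid_add
begin

definition zero_list :: "'a list" where "zero_list = []"

definition plus_list :: "'a list \<Rightarrow> 'a list \<Rightarrow> 'a list" where "plus_list xs ys = xs @ ys"

instance by standard (simp_all add: zero_list_def plus_list_def)

end

type_synonym 'x ncpoly = "'x list \<Rightarrow>\<^sub>0 int"

definition ncvar :: "'x \<Rightarrow> 'x ncpoly" where
  "ncvar x = Poly_Mapping.single [x] 1"

definition nonneg_coeffs :: "'x ncpoly \<Rightarrow> bool" where
  "nonneg_coeffs p \<longleftrightarrow> (\<forall>w. 0 \<le> Poly_Mapping.lookup p w)"

definition ncsubst :: "('x \<Rightarrow> 'y ncpoly) \<Rightarrow> 'x ncpoly \<Rightarrow> 'y ncpoly" where
  "ncsubst f p = (\<Sum>w\<in>Poly_Mapping.keys p. of_int (Poly_Mapping.lookup p w) * prod_list (map f w))"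

datatype ab_var = Var_a | Var_b

datatype cd_var = Var_c | Var_d

abbreviation a_poly :: "ab_var ncpoly" where "a_poly \<equiv> ncvar Var_a"

abbreviation b_poly :: "ab_var ncpoly" where "b_poly \<equiv> ncvar Var_b"

fun cd_in_ab :: "cd_var \<Rightarrow> ab_var ncpoly" where
  "cd_in_ab Var_c = a_poly + b_poly"
| "cd_in_ab Var_d = a_poly * b_poly + b_poly * a_poly"


section \<open>Graded and Eulerian posets\<close>

text \<open>A poset is given by its reflexive order relation \<open>r\<close>; its set of elements is \<open>Field r\<close>.\<close>

definition poset_less :: "'a rel \<Rightarrow> 'a \<Rightarrow> 'a \<Rightarrow> bool" where
  "poset_less r x y \<longleftrightarrow> (x, y) \<in> r \<and> x \<noteq> y"

definition poset_covers :: "'a rel \<Rightarrow> 'a \<Rightarrow> 'a \<Rightarrow> bool" where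
  "poset_covers r x y \<longleftrightarrow> poset_less r x y \<and> \<not> (\<exists>z. poset_less r x z \<and> poset_less r z y)"

definition is_bottom :: "'a rel \<Rightarrow> 'a \<Rightarrow> bool" where
  "is_bottom r x \<longleftrightarrow> x \<in> Field r \<and> (\<forall>y\<in>Field r. (x, y) \<in> r)"

definition is_top :: "'a rel \<Rightarrow> 'a \<Rightarrow> bool" where
  "is_top r x \<longleftrightarrow> x \<in> Field r \<and> (\<forall>y\<in>Field r. (y, x) \<in> r)"

definition poset_bot :: "'a rel \<Rightarrow> 'a" where
  "poset_bot r = (THE x. is_bottom r x)"

definition poset_top :: "'a rel \<Rightarrow> 'a" where
  "poset_top r = (THE x. is_top r x)"

definition is_rank_function :: "'a rel \<Rightarrow> ('a \<Rightarrow> nat) \<Rightarrow> bool" where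
  "is_rank_function r \<rho> \<longleftrightarrow>
     \<rho> (poset_bot r) = 0 \<and> (\<forall>x y. poset_covers r x y \<longrightarrow> \<rho> y = \<rho> x + 1)"

definition graded_poset :: "'a rel \<Rightarrow> bool" where
  "graded_poset r \<longleftrightarrow>
     Partial_order r \<and> finite (Field r) \<and> (\<exists>x. is_bottom r x) \<and> (\<exists>x. is_top r x) \<and>
     (\<exists>\<rho>. is_rank_function r \<rho>)"

text \<open>In a graded poset the values of a rank function on \<open>Field r\<close> are determined.\<close>

definition rank_of :: "'a rel \<Rightarrow> 'a \<Rightarrow> nat" where
  "rank_of r = (SOME \<rho>. is_rank_function r \<rho>)"

definition rank_diff :: "'a rel \<Rightarrow> 'a \<Rightarrow> 'a \<Rightarrow> nat" where
  "rank_diff r x y = rank_of r y - rank_of r x"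

definition poset_rank :: "'a rel \<Rightarrow> nat" where
  "poset_rank r = rank_of r (poset_top r)"

definition poset_interval :: "'a rel \<Rightarrow> 'a \<Rightarrow> 'a \<Rightarrow> 'a set" where
  "poset_interval r x y = {z. (x, z) \<in> r \<and> (z, y) \<in> r}"

definition eulerian_poset :: "'a rel \<Rightarrow> bool" where
  "eulerian_poset r \<longleftrightarrow> graded_poset r \<and>
     (\<forall>x y. poset_less r x y \<longrightarrow>
        card {z \<in> poset_interval r x y. even (rank_of r z)} =
        card {z \<in> poset_interval r x y. odd (rank_of r z)})"


section \<open>The ab-index and the cd-index\<close>

text \<open>The chains from bottom to top, as strictly increasing lists.\<close>

definition bot_top_chains :: "'a rel \<Rightarrow> 'a list set" where
  "bot_top_chains r =
     {xs. xs \<noteq> [] \<and> hd xs = poset_bot r \<and> last xs = poset_top r \<and> sorted_wrt (poset_less r) xs}"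

text \<open>For rank at least one every chain has at least two elements; the last clause is a dummy.\<close>

fun chain_weight :: "'a rel \<Rightarrow> 'a list \<Rightarrow> ab_var ncpoly" where
  "chain_weight r (x # y # z # zs) =
     (a_poly - b_poly) ^ (rank_diff r x y - 1) * b_poly * chain_weight r (y # z # zs)"
| "chain_weight r [x, y] = (a_poly - b_poly) ^ (rank_diff r x y - 1)"
| "chain_weight r _ = 0"

definition ab_index :: "'a rel \<Rightarrow> ab_var ncpoly" where
  "ab_index r = (\<Sum>xs\<in>bot_top_chains r. chain_weight r xs)"

text \<open>
  Since \<open>a + b\<close> and \<open>a b + b a\<close> are algebraically independent, at most one \<open>\<Phi>\<close> satisfies this.
\<close>

definition is_cd_index :: "'a rel \<Rightarrow> cd_var ncpoly \<Rightarrow> bool" where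
  "is_cd_index r \<Phi> \<longleftrightarrow> ncsubst cd_in_ab \<Phi> = ab_index r"


section \<open>The Tchebyshev transform\<close>

text \<open>\<open>None\<close> is the new minimal element.\<close>

definition adjoin_bot :: "'a rel \<Rightarrow> 'a option rel" where
  "adjoin_bot r =
     {(None, None)} \<union> {(None, Some y) |y. y \<in> Field r} \<union> {(Some x, Some y) |x y. (x, y) \<in> r}"

text \<open>\<open>Some (x, y)\<close> is the element \<open>[x, y]\<close> of the transform, and \<open>None\<close> is its maximal element.\<close>

type_synonym 'a tcheb = "('a option \<times> 'a option) option"

definition tcheb_carrier :: "'a rel \<Rightarrow> 'a tcheb set" where
  "tcheb_carrier r = insert None {Some (x, y) |x y. poset_less (adjoin_bot r) x y}"

inductive tcheb_cover :: "'a rel \<Rightarrow> 'a tcheb \<Rightarrow> 'a tcheb \<Rightarrow> bool" for r :: "'a rel" where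
  shift: "poset_less (adjoin_bot r) x y \<Longrightarrow> poset_covers (adjoin_bot r) y w \<Longrightarrow>
     tcheb_cover r (Some (x, y)) (Some (y, w))"
| extend: "poset_less (adjoin_bot r) x y \<Longrightarrow> poset_covers (adjoin_bot r) y w \<Longrightarrow>
     tcheb_cover r (Some (x, y)) (Some (x, w))"
| top: "poset_less (adjoin_bot r) x (Some (poset_top r)) \<Longrightarrow>
     tcheb_cover r (Some (x, Some (poset_top r))) None"

definition tchebyshev :: "'a rel \<Rightarrow> 'a tcheb rel" where
  "tchebyshev r = {(u, v). u \<in> tcheb_carrier r \<and> v \<in> tcheb_carrier r \<and> (tcheb_cover r)\<^sup>*\<^sup>* u v}"

end

theory Submission
  imports Defs
begin

text \<open>
  Put \<open>t = a - b\<close>, and let \<open>C y\<close> be the sum of the weights of the chains of \<open>P\<close> from \<open>y\<close> to the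
  maximal element, so that \<open>C\<close> at the minimal element is the ab-index. In the transform,
  \<open>[x, y] \<le> [z, w]\<close> holds iff \<open>x = z\<close> and \<open>y \<le> w\<close>, or \<open>y \<le> z\<close>. A step of a chain that starts in
  \<open>[x, y]\<close> and moves the upper end from \<open>y\<close> to \<open>w\<close> can keep \<open>x\<close> or replace it by any \<open>z\<close> with
  \<open>y \<le> z < w\<close>. These are as many choices as the interval \<open>[y, w]\<close> has elements, and what
  can follow depends on \<open>w\<close> only. Hence the chain sum \<open>K y\<close> of the transform from \<open>[x, y]\<close> upwards
  is independent of \<open>x\<close>, and for \<open>y\<close> below the maximal element it satisfies
  \<open>K y = t ^ \<rho>(y, 1) + (\<Sum>w>y. card [y, w] * t ^ (\<rho>(y, w) - 1) * b * K w)\<close>; at the maximal element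
  it is \<open>1\<close>.

  The factor \<open>card [y, w]\<close> is \<open>2\<close> plus the number of \<open>z\<close> strictly between, so it can be produced by
  inserting one optional intermediate element in each step. This is the work of a transducer with
  two states that reads an ab-polynomial: there are linear maps \<open>tau0\<close> and \<open>tau1\<close> that
  commute with left multiplication by \<open>t\<close> and satisfy
  \<open>tau0 (b p) = t tau1 p\<close> and \<open>tau1 (b p) = b (tau0 p + 2 tau1 p)\<close>. With the starting values
  \<open>tau0 1 = t\<close> and \<open>tau1 1 = b\<close>, the recursion for chain sums gives
  \<open>K y = tau0 (C y) + 2 tau1 (C y)\<close> for \<open>y\<close> below the maximal element (lemmas
  \<open>tcheb_sum_step\<close> and \<open>chain_sum_tchebyshev\<close>). So the ab-index of the transform is \<open>tau0 + 2 tau1\<close>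
  applied to the ab-index of \<open>P\<close> (theorem \<open>ab_index_tchebyshev\<close>).

  Positivity becomes visible in the right basis. With \<open>c = t + 2 b\<close> and
  \<open>d = t b + b t + 2 b b\<close>, the pair \<open>(tau0 p, tau1 p)\<close> for a cd-word \<open>p\<close> has the form
  \<open>(t X, b X + Y)\<close> where \<open>X\<close> and \<open>Y\<close> are cd-polynomials, and \<open>X\<close> and \<open>Y\<close> obey recursions
  with non-negative coefficients (lemma \<open>tau_cd_word\<close>). Finally
  \<open>tau0 p + 2 tau1 p = (t + 2 b) X + 2 Y = c X + 2 Y\<close> is again a cd-polynomial with non-negative
  coefficients.
\<close>


section \<open>Linear extension from words to noncommutative polynomials\<close>

text \<open>
  Linear extension from words, \<open>frag_extend\<close>, is additive by itself. Its compatibility with left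
  multiplication is what turns a recursion on words into a recursion for the extended map.
\<close>

lemma frag_cmul_eq_mult:
  fixes p :: "'x ncpoly"
  shows "frag_cmul k p = of_int k * p"
proof -
  have nat: "frag_cmul (int n) p = of_int (int n) * p" for n
    by (induction n) (simp_all add: frag_cmul_distrib algebra_simps)
  show ?thesis
  proof (cases "k \<ge> 0")
    case True
    then show ?thesis using nat[of "nat k"] by simp
  next
    case False
    have "frag_cmul k p = - frag_cmul (- k) p" by simp
    also have "\<dots> = - (of_int (- k) * p)"
      using False nat[of "nat (- k)"] by (simp del: minus_frag_cmul)
    finally show ?thesis by simp
  qed
qed

lemma frag_extend_mult_left:
  fixes q :: "'y ncpoly"
  shows "frag_extend (\<lambda>w. q * f w) p = q * frag_extend f p"
proof -
  have "of_int k * (q * r) = q * (of_int k * r)" for k and r :: "'y ncpoly"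
    by (metis mult.assoc mult_of_int_commute)
  then show ?thesis
    by (simp add: frag_extend_def frag_cmul_eq_mult sum_distrib_left)
qed

lemma frag_extend_fun_add:
  "frag_extend (\<lambda>w. f w + g w) p = frag_extend f p + frag_extend g p"
  by (simp add: frag_extend_def frag_cmul_distrib2 sum.distrib)

lemma frag_extend_ncvar_mult:
  "frag_extend f (ncvar x * p) = frag_extend (\<lambda>w. f (x # w)) p"
proof (rule frag_induction[of p UNIV])
  show "frag_extend f (ncvar x * frag_of w) = frag_extend (\<lambda>w. f (x # w)) (frag_of w)" for w
    by (simp add: ncvar_def mult_single plus_list_def)
qed (simp_all add: frag_extend_diff algebra_simps)

lemma ncsubst_eq_frag_extend: "ncsubst f = frag_extend (\<lambda>w. prod_list (map f w))"
  by (simp add: fun_eq_iff ncsubst_def frag_extend_def frag_cmul_eq_mult)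


section \<open>The two-state transducer on ab-polynomials\<close>

abbreviation t_poly :: "ab_var ncpoly" where "t_poly \<equiv> a_poly - b_poly"

text \<open>
  Think of words in \<open>t\<close> and \<open>b\<close>; the letter \<open>a\<close> acts as \<open>t + b\<close>. State 1 turns the next \<open>b\<close>, or the
  right end of the word, into the \<open>b\<close> that ends the current step of a chain. State 0 erases the next
  \<open>b\<close>, which is the intermediate element of the step, to \<open>t\<close> and goes on in state 1; if no \<open>b\<close>
  follows, it produces the last step of the chain, which ends in the maximal element of the transform.
  After the \<open>b\<close> that ends a step, the next step starts in state 0 once and in state 1 twice.
\<close>

fun tau0_word :: "ab_var list \<Rightarrow> ab_var ncpoly" and tau1_word :: "ab_var list \<Rightarrow> ab_var ncpoly" where
  "tau0_word [] = t_poly"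
| "tau0_word (Var_a # w) = t_poly * tau0_word w + t_poly * tau1_word w"
| "tau0_word (Var_b # w) = t_poly * tau1_word w"
| "tau1_word [] = b_poly"
| "tau1_word (Var_a # w) = t_poly * tau1_word w + (b_poly * tau0_word w + 2 * b_poly * tau1_word w)"
| "tau1_word (Var_b # w) = b_poly * tau0_word w + 2 * b_poly * tau1_word w"

definition "tau0 = frag_extend tau0_word"
definition "tau1 = frag_extend tau1_word"

lemma tau_add: "tau0 (p + q) = tau0 p + tau0 q" "tau1 (p + q) = tau1 p + tau1 q"
  by (simp_all add: tau0_def tau1_def frag_extend_add)

lemma tau_sum: "finite I \<Longrightarrow> tau0 (sum f I) = (\<Sum>i\<in>I. tau0 (f i))"
   "finite I \<Longrightarrow> tau1 (sum f I) = (\<Sum>i\<in>I. tau1 (f i))"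
  by (simp_all add: tau0_def tau1_def frag_extend_sum o_def)

lemma tau_1: "tau0 1 = t_poly" "tau1 1 = b_poly"
  using frag_extend_of[of tau0_word "[]"] frag_extend_of[of tau1_word "[]"]
  by (simp_all add: tau0_def tau1_def single_one zero_list_def flip: single_one)

lemma tau_b: "tau0 (b_poly * p) = t_poly * tau1 p"
   "tau1 (b_poly * p) = b_poly * tau0 p + 2 * b_poly * tau1 p"
  by (simp_all add: tau0_def tau1_def frag_extend_ncvar_mult frag_extend_mult_left frag_extend_fun_add)

text \<open>
  The values at \<open>a p\<close> contain those at \<open>b p\<close> as a summand, which cancels in \<open>t p = a p - b p\<close>.
\<close>

lemma tau_t: "tau0 (t_poly * p) = t_poly * tau0 p" "tau1 (t_poly * p) = t_poly * tau1 p"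
proof -
  have "tau0 (a_poly * p) = t_poly * tau0 p + t_poly * tau1 p"
   "tau1 (a_poly * p) = t_poly * tau1 p + (b_poly * tau0 p + 2 * b_poly * tau1 p)"
    by (simp_all add: tau0_def tau1_def frag_extend_ncvar_mult frag_extend_mult_left frag_extend_fun_add)
  moreover have "tau0 (t_poly * p) = tau0 (a_poly * p) - tau0 (b_poly * p)"
      "tau1 (t_poly * p) = tau1 (a_poly * p) - tau1 (b_poly * p)"
    by (simp_all add: tau0_def tau1_def left_diff_distrib frag_extend_diff)
  ultimately show "tau0 (t_poly * p) = t_poly * tau0 p" "tau1 (t_poly * p) = t_poly * tau1 p"
    by (simp_all add: tau_b)
qed

lemma tau_t_power: "tau0 (t_poly ^ k * p) = t_poly ^ k * tau0 p"
  "tau1 (t_poly ^ k * p) = t_poly ^ k * tau1 p"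
  by (induction k) (simp_all add: mult.assoc tau_t)


section \<open>Positivity on cd-words\<close>

abbreviation "c_poly \<equiv> ncvar Var_c"
abbreviation "d_poly \<equiv> ncvar Var_d"

text \<open>
  These recursions are forced by \<open>tau0 w = t X\<close> and \<open>tau1 w = b X + Y\<close> on cd-words \<open>w\<close>: the columns
  \<open>g = (t, b)\<close> and \<open>h = (0, 1)\<close> span a right module over the cd-polynomials that the transducer
  preserves, with \<open>c g = g c + h d\<close>, \<open>c h = 2 g + h c\<close>, \<open>d g = 2 g d + h d c\<close> and
  \<open>d h = 2 g c + 2 h d\<close>, where the letter on the left acts by the transducer.
\<close>

fun X_word :: "cd_var list \<Rightarrow> cd_var ncpoly" and Y_word :: "cd_var list \<Rightarrow> cd_var ncpoly" where
  "X_word [] = 1"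
| "X_word (Var_c # w) = c_poly * X_word w + 2 * Y_word w"
| "X_word (Var_d # w) = 2 * (d_poly * X_word w) + 2 * (c_poly * Y_word w)"
| "Y_word [] = 0"
| "Y_word (Var_c # w) = d_poly * X_word w + c_poly * Y_word w"
| "Y_word (Var_d # w) = d_poly * (c_poly * X_word w) + 2 * (d_poly * Y_word w)"

abbreviation "cd_eval \<equiv> ncsubst cd_in_ab"

lemma cd_eval_add: "cd_eval (p + q) = cd_eval p + cd_eval q"
  and cd_eval_ncvar_mult: "cd_eval (ncvar x * p) = cd_in_ab x * cd_eval p"
  and cd_eval_0: "cd_eval 0 = 0"
  by (simp_all add: ncsubst_eq_frag_extend frag_extend_add frag_extend_ncvar_mult frag_extend_mult_left)

lemma cd_eval_1: "cd_eval 1 = 1"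
  using frag_extend_of[of "\<lambda>w. prod_list (map cd_in_ab w)" "[]"]
  by (simp add: ncsubst_eq_frag_extend zero_list_def flip: single_one)

lemma cd_eval_double: "cd_eval (2 * p) = 2 * cd_eval p"
  by (simp add: mult_2 cd_eval_add)

lemma tau_cd_word:
  "tau0 (prod_list (map cd_in_ab w)) = t_poly * cd_eval (X_word w)"
  "tau1 (prod_list (map cd_in_ab w)) = b_poly * cd_eval (X_word w) + cd_eval (Y_word w)"
proof (induction w)
  case Nil
  {
    case 1 show ?case by (simp add: tau_1 cd_eval_1)
  next
    case 2 show ?case by (simp add: tau_1 cd_eval_1 cd_eval_0)
  }
next
  case (Cons x w)
  define p where "p = prod_list (map cd_in_ab w)"
  define X where "X = cd_eval (X_word w)"
  define Y where "Y = cd_eval (Y_word w)"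
  \<comment> \<open>The transducer is known on \<open>t\<close> and \<open>b\<close>: use \<open>c = t + 2 b\<close> and \<open>d = t b + b t + 2 b b\<close>.\<close>
  have c: "cd_in_ab Var_c * p = t_poly * p + b_poly * p + b_poly * p"
    by (simp add: algebra_simps)
  have d: "cd_in_ab Var_d * p = t_poly * (b_poly * p) + b_poly * (t_poly * p)
      + b_poly * (b_poly * p) + b_poly * (b_poly * p)"
    by (simp add: algebra_simps)
  have IH: "tau0 p = t_poly * X" "tau1 p = b_poly * X + Y"
    using Cons.IH by (simp_all add: p_def X_def Y_def)
  {
    case 1 show ?case
    proof (cases x)
      case Var_c
      have "tau0 (cd_in_ab x * p) = t_poly * ((a_poly + b_poly) * X + 2 * Y)"
        unfolding Var_c c tau_add tau_t tau_b IH by (simp add: algebra_simps mult_2 mult_2_right)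
      then show ?thesis using Var_c
        by (simp add: cd_eval_add cd_eval_double cd_eval_ncvar_mult flip: p_def X_def Y_def)
    next
      case Var_d
      have "tau0 (cd_in_ab x * p) = t_poly * (2 * (cd_in_ab Var_d * X) + 2 * (cd_in_ab Var_c * Y))"
        unfolding Var_d d tau_add tau_t tau_b IH by (simp add: algebra_simps mult_2 mult_2_right)
      then show ?thesis using Var_d
        by (simp add: cd_eval_add cd_eval_double cd_eval_ncvar_mult flip: p_def X_def Y_def)
    qed
  next
    case 2 show ?case
    proof (cases x)
      case Var_c
      have "tau1 (cd_in_ab x * p) = b_poly * ((a_poly + b_poly) * X + 2 * Y)
        + (cd_in_ab Var_d * X + cd_in_ab Var_c * Y)"
        unfolding Var_c c tau_add tau_t tau_b IH by (simp add: algebra_simps mult_2 mult_2_right)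
      then show ?thesis using Var_c
        by (simp add: cd_eval_add cd_eval_double cd_eval_ncvar_mult flip: p_def X_def Y_def)
    next
      case Var_d
      have "tau1 (cd_in_ab x * p) = b_poly * (2 * (cd_in_ab Var_d * X) + 2 * (cd_in_ab Var_c * Y))
         + (cd_in_ab Var_d * (cd_in_ab Var_c * X) + 2 * (cd_in_ab Var_d * Y))"
        unfolding Var_d d tau_add tau_t tau_b IH by (simp add: algebra_simps mult_2 mult_2_right)
      then show ?thesis using Var_d
        by (simp add: cd_eval_add cd_eval_double cd_eval_ncvar_mult flip: p_def X_def Y_def)
    qed
  }
qed

text \<open>
  The cd-polynomial \<open>c X + 2 Y\<close>, obtained from \<open>tau0 + 2 tau1\<close> on each cd-word by
  \<open>t X + 2 (b X + Y) = (t + 2 b) X + 2 Y\<close>.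
\<close>

definition "tcheb_cd = frag_extend (\<lambda>w. c_poly * X_word w + 2 * Y_word w)"

lemma cd_eval_tcheb_cd:
  "cd_eval (tcheb_cd \<Phi>) = tau0 (cd_eval \<Phi>) + 2 * tau1 (cd_eval \<Phi>)"
  unfolding tcheb_cd_def
proof (rule frag_induction[of \<Phi> UNIV])
  show "cd_eval (frag_extend (\<lambda>w. c_poly * X_word w + 2 * Y_word w) (frag_of w)) =
     tau0 (cd_eval (frag_of w)) + 2 * tau1 (cd_eval (frag_of w))" for w
  proof -
    have "cd_eval (frag_of w) = prod_list (map cd_in_ab w)"
      by (simp add: ncsubst_eq_frag_extend)
    then show ?thesis
      by (simp add: tau_cd_word cd_eval_add cd_eval_ncvar_mult cd_eval_double algebra_simps mult_2 mult_2_right)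
  qed
qed (simp_all add: ncsubst_eq_frag_extend tau0_def tau1_def frag_extend_diff algebra_simps)

lemma nonneg_coeffs_add: "nonneg_coeffs p \<Longrightarrow> nonneg_coeffs q \<Longrightarrow> nonneg_coeffs (p + q)"
  by (simp add: nonneg_coeffs_def lookup_add)

lemma nonneg_coeffs_sum: "(\<And>i. i \<in> I \<Longrightarrow> nonneg_coeffs (f i)) \<Longrightarrow> nonneg_coeffs (sum f I)"
  by (simp add: nonneg_coeffs_def lookup_sum sum_nonneg)

lemma nonneg_coeffs_frag_extend:
  assumes "nonneg_coeffs p" "\<And>w. nonneg_coeffs (f w)"
  shows "nonneg_coeffs (frag_extend f p)"
  unfolding frag_extend_def
  by (rule nonneg_coeffs_sum) (use assms in \<open>simp add: nonneg_coeffs_def\<close>)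

text \<open>
  Left multiplication by a letter only relabels the words.
\<close>

lemma nonneg_coeffs_ncvar_mult:
  assumes "nonneg_coeffs p"
  shows "nonneg_coeffs (ncvar x * p)"
proof -
  have "ncvar x * p = frag_extend (\<lambda>w. frag_of (x # w)) p"
    using frag_extend_ncvar_mult[of frag_of x p] by (simp flip: frag_expansion)
  moreover have "nonneg_coeffs (frag_of w)" for w :: "'a list"
    by (simp add: nonneg_coeffs_def lookup_single when_def)
  ultimately show ?thesis
    using nonneg_coeffs_frag_extend[OF assms] by metis
qed

lemma nonneg_coeffs_X_Y: "nonneg_coeffs (X_word w)" "nonneg_coeffs (Y_word w)"
  by (induction w rule: X_word_Y_word.induct)
   (auto simp: mult_2 lookup_one when_def intro!: nonneg_coeffs_add nonneg_coeffs_ncvar_mult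
     simp: nonneg_coeffs_def[of 0] nonneg_coeffs_def[of 1])

lemma nonneg_coeffs_tcheb_cd: "nonneg_coeffs \<Phi> \<Longrightarrow> nonneg_coeffs (tcheb_cd \<Phi>)"
  unfolding tcheb_cd_def mult_2
  by (intro nonneg_coeffs_frag_extend nonneg_coeffs_add nonneg_coeffs_ncvar_mult nonneg_coeffs_X_Y)


section \<open>Chain sums in finite posets\<close>

locale finite_poset =
  fixes r :: "'a rel"
  assumes partial_order: "Partial_order r" and finite_Field: "finite (Field r)"
begin

lemma le_refl: "x \<in> Field r \<Longrightarrow> (x, x) \<in> r"
  using partial_order by (simp add: partial_order_on_def preorder_on_def refl_on_def)

lemma le_trans: "(x, y) \<in> r \<Longrightarrow> (y, z) \<in> r \<Longrightarrow> (x, z) \<in> r"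
  using partial_order by (auto simp: partial_order_on_def preorder_on_def dest: transD)

lemma le_antisym: "(x, y) \<in> r \<Longrightarrow> (y, x) \<in> r \<Longrightarrow> x = y"
  using partial_order by (auto simp: partial_order_on_def dest: antisymD)

lemma le_Field: "(x, y) \<in> r \<Longrightarrow> x \<in> Field r" "(x, y) \<in> r \<Longrightarrow> y \<in> Field r"
  by (auto simp: Field_def)

lemma less_le_trans: "poset_less r x y \<Longrightarrow> (y, z) \<in> r \<Longrightarrow> poset_less r x z"
  unfolding poset_less_def using le_trans[of x y z] le_antisym[of x y] by blast

lemma le_less_trans: "(x, y) \<in> r \<Longrightarrow> poset_less r y z \<Longrightarrow> poset_less r x z"
  unfolding poset_less_def using le_trans[of x y z] le_antisym[of y z] by blast

lemma less_trans: "poset_less r x y \<Longrightarrow> poset_less r y z \<Longrightarrow> poset_less r x z"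
  using less_le_trans[of x y z] by (simp add: poset_less_def)

lemma transp_less: "transp (poset_less r)"
  using less_trans by (rule transpI)

lemma covers_path_le:
  assumes "(poset_covers r)\<^sup>*\<^sup>* x y" "x \<in> Field r"
  shows "(x, y) \<in> r"
  using assms(1)
proof induction
  case base
  show ?case using assms(2) by (rule le_refl)
next
  case (step y z)
  then show ?case using le_trans[of x y z] by (simp add: poset_covers_def poset_less_def)
qed

lemma poset_top_eq: "is_top r x \<Longrightarrow> poset_top r = x"
  unfolding poset_top_def by (rule the_equality, assumption, rule le_antisym) (simp_all add: is_top_def)

lemma poset_bot_eq: "is_bottom r x \<Longrightarrow> poset_bot r = x"
  unfolding poset_bot_def by (rule the_equality, assumption, rule le_antisym) (simp_all add: is_bottom_def)

text \<open>
  A step that is not a cover splits at an intermediate element into two smaller intervals.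
\<close>

lemma saturated_chain:
  assumes "(x, y) \<in> r"
  shows "(poset_covers r)\<^sup>*\<^sup>* x y"
  using assms
proof (induction "card {z. (x, z) \<in> r \<and> (z, y) \<in> r}" arbitrary: x y rule: less_induct)
  case less
  have fin: "finite {z. (u, z) \<in> r \<and> (z, v) \<in> r}" for u v
    by (rule finite_subset[OF _ finite_Field]) (auto simp: Field_def)
  show ?case
  proof (cases "x = y \<or> poset_covers r x y")
    case False
    then obtain z where z: "poset_less r x z" "poset_less r z y"
      using less.prems by (auto simp: poset_covers_def poset_less_def)
    have "z \<in> {u. (x, u) \<in> r \<and> (u, y) \<in> r}" "x \<in> {u. (x, u) \<in> r \<and> (u, y) \<in> r}"
      "y \<in> {u. (x, u) \<in> r \<and> (u, y) \<in> r}"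
      using z less.prems by (simp_all add: poset_less_def le_refl le_Field)
    moreover have "y \<notin> {u. (x, u) \<in> r \<and> (u, z) \<in> r}" "x \<notin> {u. (z, u) \<in> r \<and> (u, y) \<in> r}"
      using z by (auto simp: poset_less_def dest: le_antisym)
    moreover have "{u. (x, u) \<in> r \<and> (u, z) \<in> r} \<subseteq> {u. (x, u) \<in> r \<and> (u, y) \<in> r}"
      "{u. (z, u) \<in> r \<and> (u, y) \<in> r} \<subseteq> {u. (x, u) \<in> r \<and> (u, y) \<in> r}"
      using z le_trans unfolding poset_less_def by blast+
    ultimately have "{u. (x, u) \<in> r \<and> (u, z) \<in> r} \<subset> {u. (x, u) \<in> r \<and> (u, y) \<in> r}"
      "{u. (z, u) \<in> r \<and> (u, y) \<in> r} \<subset> {u. (x, u) \<in> r \<and> (u, y) \<in> r}"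
      by auto
    then have "(poset_covers r)\<^sup>*\<^sup>* x z" "(poset_covers r)\<^sup>*\<^sup>* z y"
      using z by (auto simp: poset_less_def intro!: less.hyps psubset_card_mono[OF fin])
    then show ?thesis by auto
  qed auto
qed

lemma rank_mono:
  assumes "is_rank_function r \<rho>" "(x, y) \<in> r"
  shows "\<rho> x \<le> \<rho> y" "x \<noteq> y \<Longrightarrow> \<rho> x < \<rho> y"
proof -
  have "\<rho> x \<le> \<rho> y \<and> (x \<noteq> y \<longrightarrow> \<rho> x < \<rho> y)"
    using saturated_chain[OF assms(2)]
    by induction (use assms(1) in \<open>auto simp: is_rank_function_def\<close>)
  then show "\<rho> x \<le> \<rho> y" "x \<noteq> y \<Longrightarrow> \<rho> x < \<rho> y" by auto
qed

definition chains_from :: "'a \<Rightarrow> 'a list set" where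
  "chains_from x = {xs. xs \<noteq> [] \<and> hd xs = x \<and> last xs = poset_top r \<and> sorted_wrt (poset_less r) xs}"

definition chain_sum :: "'a \<Rightarrow> ab_var ncpoly" where
  "chain_sum x = (\<Sum>xs\<in>chains_from x. chain_weight r xs)"

lemma ab_index_eq_chain_sum: "ab_index r = chain_sum (poset_bot r)"
  by (simp add: ab_index_def chain_sum_def bot_top_chains_def chains_from_def)

lemma finite_chains_from: "finite (chains_from x)"
proof (rule finite_subset)
  have "distinct xs" if "sorted_wrt (poset_less r) xs" for xs
    using that by (induction xs) (auto simp: poset_less_def)
  moreover have "set xs \<subseteq> insert x (Field r)" if "xs \<in> chains_from x" for xs
    using that by (cases xs) (auto simp: chains_from_def poset_less_def Field_def)
  ultimately show "chains_from x \<subseteq> {xs. set xs \<subseteq> insert x (Field r) \<and> distinct xs}"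
    by (auto simp: chains_from_def)
  show "finite {xs. set xs \<subseteq> insert x (Field r) \<and> distinct xs}"
    using finite_Field by (simp add: finite_subset_distinct)
qed

lemma not_top_less:
  assumes "is_top r m"
  shows "\<not> poset_less r m x"
  using assms le_antisym[of m x] le_Field(2)[of m x] unfolding is_top_def poset_less_def by blast

lemma chains_from_top:
  assumes "is_top r m"
  shows "chains_from m = {[m]}"
proof -
  have "xs = [m]" if "xs \<in> chains_from m" for xs
    using that not_top_less[OF assms] by (cases xs rule: remdups_adj.cases) (auto simp: chains_from_def)
  then show ?thesis
    using poset_top_eq[OF assms] by (auto simp: chains_from_def)
qed

lemma chains_from_step:
  assumes "x \<noteq> poset_top r"
  shows "chains_from x = (\<Union>y\<in>{y. poset_less r x y}. (#) x ` chains_from y)"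
proof (intro equalityI subsetI)
  fix xs assume xs: "xs \<in> chains_from x"
  then obtain y ys where "xs = x # y # ys"
    using assms by (cases xs rule: remdups_adj.cases) (auto simp: chains_from_def)
  then show "xs \<in> (\<Union>y\<in>{y. poset_less r x y}. (#) x ` chains_from y)"
    using xs by (auto simp: chains_from_def)
next
  fix xs assume "xs \<in> (\<Union>y\<in>{y. poset_less r x y}. (#) x ` chains_from y)"
  then obtain y ys where "poset_less r x y" "ys \<in> chains_from y" "xs = x # ys"
    by auto
  then show "xs \<in> chains_from x"
    by (cases ys) (simp_all add: chains_from_def sorted_wrt2[OF transp_less] del: sorted_wrt.simps(2))
qed

text \<open>
  The chains are sorted by their second element; the chain that jumps straight to the
  top is split off, because its weight has no \<open>b\<close>.
\<close>

lemma chain_sum_step: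
  assumes top: "is_top r m" and less: "poset_less r x m"
  shows "chain_sum x = t_poly ^ (rank_diff r x m - 1) +
    (\<Sum>y | poset_less r x y \<and> poset_less r y m.
       t_poly ^ (rank_diff r x y - 1) * b_poly * chain_sum y)"
proof -
  let ?U = "{y. poset_less r x y \<and> poset_less r y m}"
  have fin: "finite ?U"
    by (rule finite_subset[OF _ finite_Field]) (auto simp: poset_less_def Field_def)
  have U: "{y. poset_less r x y} = insert m ?U"
    using top less by (auto simp: is_top_def poset_less_def Field_def)
  have m: "poset_top r = m" by (rule poset_top_eq[OF top])
  have step: "(\<Sum>xs\<in>(#) x ` chains_from y. chain_weight r xs) =
      t_poly ^ (rank_diff r x y - 1) * b_poly * chain_sum y" if "y \<in> ?U" for y
  proof -
    have "chain_weight r (x # ys) = t_poly ^ (rank_diff r x y - 1) * b_poly * chain_weight r ys"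
      if ys: "ys \<in> chains_from y" for ys
    proof -
      from ys \<open>y \<in> ?U\<close> m obtain z zs where "ys = y # z # zs"
        by (cases ys rule: remdups_adj.cases) (auto simp: chains_from_def poset_less_def)
      then show ?thesis by simp
    qed
    then show ?thesis
      by (simp add: sum.reindex chain_sum_def sum_distrib_left)
  qed
  have "chain_sum x = (\<Sum>y\<in>{y. poset_less r x y}. \<Sum>xs\<in>(#) x ` chains_from y. chain_weight r xs)"
    unfolding chain_sum_def using less m
    by (subst chains_from_step, simp add: poset_less_def, intro sum.UNION_disjoint)
      (use fin U finite_chains_from in \<open>auto simp: chains_from_def\<close>)
  also have "\<dots> = (\<Sum>xs\<in>(#) x ` chains_from m. chain_weight r xs) +
      (\<Sum>y\<in>?U. \<Sum>xs\<in>(#) x ` chains_from y. chain_weight r xs)"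
    unfolding U using fin by (subst sum.insert) (auto simp: poset_less_def)
  finally show ?thesis
    by (simp add: step chains_from_top[OF top])
qed

end


section \<open>The order of the Tchebyshev transform\<close>

locale bounded_ranked_poset = finite_poset r for r :: "'a rel" +
  assumes bottom: "is_bottom r (poset_bot r)" and top: "is_top r (poset_top r)"
    and rank: "is_rank_function r (rank_of r)"
begin

abbreviation "zero \<equiv> poset_bot r"
abbreviation "one \<equiv> poset_top r"

lemma rank_strict: "poset_less r x y \<Longrightarrow> rank_of r x < rank_of r y"
  using rank_mono(2)[OF rank] by (simp add: poset_less_def)

lemma rank_covers: "poset_covers r x y \<Longrightarrow> rank_of r y = rank_of r x + 1"
  using rank by (simp add: is_rank_function_def)

lemma less_one: "x \<in> Field r \<Longrightarrow> x \<noteq> one \<Longrightarrow> poset_less r x one"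
  using top by (simp add: is_top_def poset_less_def)

lemma less_Field: "poset_less r x y \<Longrightarrow> x \<in> Field r" "poset_less r x y \<Longrightarrow> y \<in> Field r"
  by (auto simp: poset_less_def Field_def)

lemma finite_above: "finite {w. poset_less r y w \<and> Q w}"
  by (rule finite_subset[OF _ finite_Field]) (auto simp: less_Field)

text \<open>
  The upper end of an interval in the extended poset is never the new minimal element, so it is an
  element of the original poset; the lower end may be \<open>None\<close>.
\<close>

definition segment :: "'a option \<Rightarrow> 'a \<Rightarrow> bool" where
  "segment x y \<longleftrightarrow> poset_less (adjoin_bot r) x (Some y)"

lemma segment_iff: "segment x y \<longleftrightarrow> y \<in> Field r \<and> (\<forall>x'. x = Some x' \<longrightarrow> poset_less r x' y)"
  by (cases x) (auto simp: segment_def adjoin_bot_def poset_less_def Field_def)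

lemma adjoin_less_iff: "poset_less (adjoin_bot r) x z \<longleftrightarrow> (\<exists>y. z = Some y \<and> segment x y)"
  by (cases z) (auto simp: segment_def adjoin_bot_def poset_less_def)

lemma adjoin_less_Some_iff:
  "poset_less (adjoin_bot r) (Some y) z \<longleftrightarrow> (\<exists>z'. z = Some z' \<and> poset_less r y z')"
  by (auto simp: adjoin_less_iff segment_iff less_Field)

lemma adjoin_covers_iff:
  "poset_covers (adjoin_bot r) (Some y) w \<longleftrightarrow> (\<exists>w'. w = Some w' \<and> poset_covers r y w')"
proof -
  have "(\<exists>z. poset_less (adjoin_bot r) (Some y) z \<and> poset_less (adjoin_bot r) z (Some w')) \<longleftrightarrow>
      (\<exists>z. poset_less r y z \<and> poset_less r z w')" for w'
    by (metis adjoin_less_Some_iff option.inject)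
  then show ?thesis
    by (auto simp: poset_covers_def adjoin_less_Some_iff[of y w])
qed

lemma segment_trans: "segment x y \<Longrightarrow> (y, w) \<in> r \<Longrightarrow> segment x w"
  by (auto simp: segment_iff le_Field intro: less_le_trans)

lemma tcheb_carrier_eq: "tcheb_carrier r = insert None {Some (x, Some y) |x y. segment x y}"
  by (auto simp: tcheb_carrier_def adjoin_less_iff)

lemma tcheb_cover_iff:
  "tcheb_cover r u v \<longleftrightarrow> (\<exists>x y. u = Some (x, Some y) \<and> segment x y \<and>
     ((\<exists>w. poset_covers r y w \<and> (v = Some (x, Some w) \<or> v = Some (Some y, Some w))) \<or>
      v = None \<and> y = one))"
  by (subst tcheb_cover.simps) (auto simp: adjoin_less_iff adjoin_covers_iff)

lemma covers_less: "poset_covers r y w \<Longrightarrow> poset_less r y w"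
  by (simp add: poset_covers_def)

lemma path_extend:
  assumes "(y, w) \<in> r" "segment x y"
  shows "(tcheb_cover r)\<^sup>*\<^sup>* (Some (x, Some y)) (Some (x, Some w))"
  using saturated_chain[OF assms(1)]
proof induction
  case (step v w)
  have "(y, v) \<in> r"
    using step.hyps(1) assms(2) by (intro covers_path_le) (simp_all add: segment_iff)
  then have "segment x v" using assms(2) by (rule segment_trans[rotated])
  then have "tcheb_cover r (Some (x, Some v)) (Some (x, Some w))"
    using step.hyps(2) by (auto simp: tcheb_cover_iff)
  with step.IH show ?case by simp
qed simp

lemma path_shift:
  assumes "(y, z) \<in> r" "poset_less r z w" "segment x y"
  shows "(tcheb_cover r)\<^sup>*\<^sup>* (Some (x, Some y)) (Some (Some z, Some w))"
proof -
  have "(poset_covers r)\<^sup>*\<^sup>* z w" "z \<noteq> w"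
    using assms(2) saturated_chain by (auto simp: poset_less_def)
  then obtain c where c: "poset_covers r z c" "(poset_covers r)\<^sup>*\<^sup>* c w"
    by (cases rule: converse_rtranclpE) auto
  have "(c, w) \<in> r"
    using c less_Field(2)[OF covers_less[OF c(1)]] by (intro covers_path_le)
  have "(tcheb_cover r)\<^sup>*\<^sup>* (Some (x, Some y)) (Some (x, Some z))"
    using assms(1,3) by (rule path_extend)
  also have "tcheb_cover r (Some (x, Some z)) (Some (Some z, Some c))"
    using c(1) segment_trans[OF assms(3,1)] by (auto simp: tcheb_cover_iff)
  also have "(tcheb_cover r)\<^sup>*\<^sup>* (Some (Some z, Some c)) (Some (Some z, Some w))"
    using \<open>(c, w) \<in> r\<close> covers_less[OF c(1)] by (intro path_extend) (auto simp: segment_iff less_Field)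
  finally show ?thesis by simp
qed

lemma path_top:
  assumes "segment x y"
  shows "(tcheb_cover r)\<^sup>*\<^sup>* (Some (x, Some y)) None"
proof -
  have "(y, one) \<in> r" using assms top by (auto simp: segment_iff is_top_def)
  then have "(tcheb_cover r)\<^sup>*\<^sup>* (Some (x, Some y)) (Some (x, Some one))" "segment x one"
    using assms path_extend segment_trans by blast+
  moreover from this(2) have "tcheb_cover r (Some (x, Some one)) None"
    by (simp add: tcheb_cover_iff)
  ultimately show ?thesis by (meson rtranclp.rtrancl_into_rtrancl)
qed

text \<open>
  The transform is given by its cover relations; this is its order in closed form. Each cover step
  keeps the lower end or moves it to the old upper end, after which it stays above \<open>y\<close>. Conversely,
  to reach \<open>[z, w]\<close> with \<open>y \<le> z\<close>, extend \<open>[x, y]\<close> to \<open>[x, z]\<close>, shift to \<open>[z, z']\<close> for a cover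
  \<open>z'\<close> of \<open>z\<close> with \<open>z' \<le> w\<close>, and extend to \<open>[z, w]\<close>.
\<close>

lemma path_iff:
  assumes "segment x y"
  shows "(tcheb_cover r)\<^sup>*\<^sup>* (Some (x, Some y)) v \<longleftrightarrow>
    v = None \<or> (\<exists>w. v = Some (x, Some w) \<and> (y, w) \<in> r) \<or>
    (\<exists>z w. v = Some (Some z, Some w) \<and> (y, z) \<in> r \<and> poset_less r z w)"
    (is "_ \<longleftrightarrow> ?R v")
proof
  show "?R v" if "(tcheb_cover r)\<^sup>*\<^sup>* (Some (x, Some y)) v"
    using that
  proof induction
    case base
    show ?case using assms by (auto simp: segment_iff le_refl)
  next
    case (step v v')
    from step.hyps(2) obtain p q where v: "v = Some (p, Some q)" "segment p q" and
      v': "(\<exists>w. poset_covers r q w \<and> (v' = Some (p, Some w) \<or> v' = Some (Some q, Some w))) \<or> v' = None"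
      by (auto simp: tcheb_cover_iff)
    show ?case
    proof (cases "v' = None")
      case False
      then obtain w where w: "poset_less r q w" "v' = Some (p, Some w) \<or> v' = Some (Some q, Some w)"
        using v' covers_less by blast
      have yq: "(y, q) \<in> r"
        using step.IH v le_trans[of y _ q] by (auto simp: poset_less_def)
      have yw: "(y, w) \<in> r"
        using yq w(1) le_trans[of y q w] by (simp add: poset_less_def)
      consider "p = x" | z where "p = Some z" "(y, z) \<in> r" "poset_less r z q"
        using step.IH v by auto
      then show ?thesis
      proof cases
        case 1
        then show ?thesis using w yq yw by auto
      next
        case 2
        have "poset_less r z w"
          using 2(3) w(1) by (rule less_trans)
        then show ?thesis using w yq 2 by auto
      qed
    qed simp
  qed
  show "(tcheb_cover r)\<^sup>*\<^sup>* (Some (x, Some y)) v" if "?R v"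
    using that
  proof (elim disjE exE conjE)
    assume "v = None"
    then show ?thesis using path_top[OF assms] by simp
  next
    fix w assume "v = Some (x, Some w)" "(y, w) \<in> r"
    then show ?thesis using path_extend[OF _ assms] by simp
  next
    fix z w assume "v = Some (Some z, Some w)" "(y, z) \<in> r" "poset_less r z w"
    then show ?thesis using path_shift[OF _ _ assms] by simp
  qed
qed

text \<open>
  The rank of \<open>[x, y]\<close> in the transform is that of \<open>y\<close>: the minimal element \<open>[-1, 0]\<close> has rank zero.
  It increases by one along each generating relation, which yields antisymmetry and shows that these
  relations are exactly the covers.
\<close>

fun tcheb_rank :: "'a tcheb \<Rightarrow> nat" where
  "tcheb_rank None = poset_rank r + 1"
| "tcheb_rank (Some (x, y)) = rank_of r (the y)"

lemma tcheb_rank_cover: "tcheb_cover r u v \<Longrightarrow> tcheb_rank v = tcheb_rank u + 1"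
  by (auto simp: tcheb_cover_iff rank_covers poset_rank_def)

lemma tcheb_rank_path:
  assumes "(tcheb_cover r)\<^sup>*\<^sup>* u v"
  shows "u = v \<or> tcheb_rank u < tcheb_rank v"
  using assms by induction (auto dest: tcheb_rank_cover)

lemma tcheb_le_iff:
  "(u, v) \<in> tchebyshev r \<longleftrightarrow>
    u \<in> tcheb_carrier r \<and> v \<in> tcheb_carrier r \<and> (tcheb_cover r)\<^sup>*\<^sup>* u v"
  by (simp add: tchebyshev_def)

lemma Field_tchebyshev: "Field (tchebyshev r) = tcheb_carrier r"
  by (auto simp: tchebyshev_def Field_def)

lemma tcheb_le_path: "(u, v) \<in> tchebyshev r \<Longrightarrow> (tcheb_cover r)\<^sup>*\<^sup>* u v"
  by (simp add: tchebyshev_def)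

lemma tcheb_rank_less: "poset_less (tchebyshev r) u v \<Longrightarrow> tcheb_rank u < tcheb_rank v"
  using tcheb_rank_path[OF tcheb_le_path, of u v] by (simp add: poset_less_def)

lemma cover_le:
  assumes "tcheb_cover r u v"
  shows "(u, v) \<in> tchebyshev r"
proof -
  from assms obtain x y where u: "u = Some (x, Some y)" "segment x y" and
    v: "(\<exists>w. poset_covers r y w \<and> (v = Some (x, Some w) \<or> v = Some (Some y, Some w))) \<or> v = None"
    by (auto simp: tcheb_cover_iff)
  have "segment x w" "segment (Some y) w" if "poset_covers r y w" for w
    using covers_less[OF that] segment_trans[OF u(2), of w]
    by (simp_all add: segment_iff less_Field poset_less_def)
  then have "v \<in> tcheb_carrier r"
    using v by (auto simp: tcheb_carrier_eq)
  then show ?thesis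
    using assms u by (simp add: tchebyshev_def tcheb_carrier_eq r_into_rtranclp)
qed

lemma poset_covers_tchebyshev_iff: "poset_covers (tchebyshev r) u v \<longleftrightarrow> tcheb_cover r u v"
proof
  assume uv: "tcheb_cover r u v"
  then have "poset_less (tchebyshev r) u v"
    using cover_le tcheb_rank_cover[OF uv] by (auto simp: poset_less_def)
  moreover have "\<not> (poset_less (tchebyshev r) u z \<and> poset_less (tchebyshev r) z v)" for z
    using tcheb_rank_cover[OF uv] tcheb_rank_less[of u z] tcheb_rank_less[of z v] by auto
  ultimately show "poset_covers (tchebyshev r) u v" by (auto simp: poset_covers_def)
next
  assume uv: "poset_covers (tchebyshev r) u v"
  then have "(tcheb_cover r)\<^sup>*\<^sup>* u v" "u \<noteq> v" "u \<in> tcheb_carrier r" "v \<in> tcheb_carrier r"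
    by (auto simp: poset_covers_def poset_less_def tchebyshev_def)
  then obtain z where z: "tcheb_cover r u z" "(tcheb_cover r)\<^sup>*\<^sup>* z v"
    by (cases rule: converse_rtranclpE) auto
  have "poset_less (tchebyshev r) u z"
    using cover_le[OF z(1)] tcheb_rank_cover[OF z(1)] by (auto simp: poset_less_def)
  moreover have "(z, v) \<in> tchebyshev r"
    using z \<open>v \<in> _\<close> cover_le[OF z(1)] by (auto simp: tchebyshev_def)
  ultimately have "z = v" using uv by (auto simp: poset_covers_def poset_less_def)
  with z(1) show "tcheb_cover r u v" by simp
qed

lemma segment_zero: "segment None zero"
  using bottom by (simp add: segment_iff is_bottom_def)

lemma is_bottom_tchebyshev: "is_bottom (tchebyshev r) (Some (None, Some zero))"
proof -
  have "(tcheb_cover r)\<^sup>*\<^sup>* (Some (None, Some zero)) v" if "v \<in> tcheb_carrier r" for v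
  proof -
    have *: "(zero, y) \<in> r" if "y \<in> Field r" for y
      using bottom that by (simp add: is_bottom_def)
    from that consider "v = None" | w where "v = Some (None, Some w)" "w \<in> Field r"
      | z w where "v = Some (Some z, Some w)" "poset_less r z w"
      unfolding tcheb_carrier_eq segment_iff by fastforce
    then show ?thesis
      unfolding path_iff[OF segment_zero] by cases (auto simp: less_Field *)
  qed
  then show ?thesis
    using segment_zero by (simp add: is_bottom_def Field_tchebyshev tcheb_le_iff) (simp add: tcheb_carrier_eq)
qed

lemma is_top_tchebyshev: "is_top (tchebyshev r) None"
  using path_top by (auto simp: is_top_def Field_tchebyshev tcheb_le_iff tcheb_carrier_eq)

lemma finite_poset_tchebyshev: "finite_poset (tchebyshev r)"
proof
  have "u = v" if "(u, v) \<in> tchebyshev r" "(v, u) \<in> tchebyshev r" for u v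
    using tcheb_rank_path[OF tcheb_le_path[OF that(1)]] tcheb_rank_path[OF tcheb_le_path[OF that(2)]]
    by auto
  then show "Partial_order (tchebyshev r)"
    unfolding partial_order_on_def preorder_on_def Field_tchebyshev
    by (auto simp: refl_on_def trans_def antisym_def) (auto simp: tchebyshev_def)
  have "tcheb_carrier r \<subseteq> insert None (Some ` (insert None (Some ` Field r) \<times> Some ` Field r))"
    by (auto simp: tcheb_carrier_eq segment_iff image_iff) (metis less_Field(1) not_None_eq)
  then show "finite (Field (tchebyshev r))"
    unfolding Field_tchebyshev by (rule finite_subset) (simp add: finite_Field)
qed

text \<open>
  The chosen rank function is pinned down only on the carrier, where every element is reached from
  the minimal one by cover steps.
\<close>

lemma rank_of_tchebyshev:
  assumes "v \<in> tcheb_carrier r"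
  shows "rank_of (tchebyshev r) v = tcheb_rank v"
proof -
  interpret T: finite_poset "tchebyshev r" by (rule finite_poset_tchebyshev)
  have bot: "poset_bot (tchebyshev r) = Some (None, Some zero)"
    by (rule T.poset_bot_eq[OF is_bottom_tchebyshev])
  have "is_rank_function (tchebyshev r) tcheb_rank"
    using rank by (auto simp: is_rank_function_def bot poset_covers_tchebyshev_iff tcheb_rank_cover)
  then have *: "is_rank_function (tchebyshev r) (rank_of (tchebyshev r))"
    by (simp only: rank_of_def) (rule someI[of "is_rank_function (tchebyshev r)" tcheb_rank])
  have "(tcheb_cover r)\<^sup>*\<^sup>* (Some (None, Some zero)) v"
    using is_bottom_tchebyshev assms unfolding is_bottom_def Field_tchebyshev tcheb_le_iff by blast
  then show ?thesis
  proof induction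
    case base
    show ?case using * rank by (simp add: is_rank_function_def bot)
  next
    case (step u v)
    then show ?case
      using * tcheb_rank_cover[of u v] by (simp add: is_rank_function_def poset_covers_tchebyshev_iff)
  qed
qed

text \<open>
  The form in which chains are counted: the upper end moves strictly up to \<open>w\<close>, and the displayed set
  lists the lower ends that are then possible.
\<close>

lemma tcheb_less_iff:
  assumes "segment x y"
  shows "poset_less (tchebyshev r) (Some (x, Some y)) v \<longleftrightarrow>
    v = None \<or> (\<exists>w z. v = Some (z, Some w) \<and> poset_less r y w \<and>
      z \<in> insert x (Some ` {z. (y, z) \<in> r \<and> poset_less r z w}))"
    (is "_ \<longleftrightarrow> ?R")
proof -
  have less: "poset_less (tchebyshev r) (Some (x, Some y)) v \<longleftrightarrow>
    v \<in> tcheb_carrier r \<and> (tcheb_cover r)\<^sup>*\<^sup>* (Some (x, Some y)) v \<and> Some (x, Some y) \<noteq> v"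
    using assms by (auto simp: poset_less_def tcheb_le_iff tcheb_carrier_eq)
  show ?thesis
    unfolding less path_iff[OF assms]
  proof (intro iffI conjI; (elim conjE)?)
    assume v: "v = None \<or> (\<exists>w. v = Some (x, Some w) \<and> (y, w) \<in> r) \<or>
      (\<exists>z w. v = Some (Some z, Some w) \<and> (y, z) \<in> r \<and> poset_less r z w)"
      "Some (x, Some y) \<noteq> v"
    then consider "v = None" | w where "v = Some (x, Some w)" "poset_less r y w"
      | z w where "v = Some (Some z, Some w)" "(y, z) \<in> r" "poset_less r z w"
      by (auto simp: poset_less_def)
    then show ?R using le_less_trans by cases auto
  next
    assume ?R
    then consider "v = None" | w where "v = Some (x, Some w)" "poset_less r y w"
      | z w where "v = Some (Some z, Some w)" "(y, z) \<in> r" "poset_less r z w"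
      by auto
    then show "v \<in> tcheb_carrier r"
    proof cases
      case (2 w)
      then show ?thesis
        using segment_trans[OF assms, of w] by (simp add: tcheb_carrier_eq poset_less_def)
    qed (auto simp: tcheb_carrier_eq segment_iff less_Field)
  next
    assume ?R
    then show "v = None \<or> (\<exists>w. v = Some (x, Some w) \<and> (y, w) \<in> r) \<or>
      (\<exists>z w. v = Some (Some z, Some w) \<and> (y, z) \<in> r \<and> poset_less r z w)"
      by (auto simp: poset_less_def)
  next
    assume ?R
    then show "Some (x, Some y) \<noteq> v" by (auto simp: poset_less_def)
  qed
qed


section \<open>Chain sums of the Tchebyshev transform\<close>

text \<open>
  This will be the chain sum of the transform from any \<open>[x, y]\<close> upwards. At the top of the poset
  only the chain \<open>[x, 1] < 1\<close> remains, whose weight is \<open>t ^ 0\<close>.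
\<close>

definition tcheb_sum :: "'a \<Rightarrow> ab_var ncpoly" where
  "tcheb_sum y = (if y = one then 1 else tau0 (chain_sum y) + 2 * tau1 (chain_sum y))"

lemma tau1_chain_sum:
  assumes "poset_less r y one"
  shows "tau1 (chain_sum y) =
    (\<Sum>w | poset_less r y w. t_poly ^ (rank_diff r y w - 1) * b_poly * tcheb_sum w)"
proof -
  let ?U = "{w. poset_less r y w \<and> poset_less r w one}"
  have "tau1 (chain_sum y) = t_poly ^ (rank_diff r y one - 1) * b_poly +
      (\<Sum>w\<in>?U. tau1 (t_poly ^ (rank_diff r y w - 1) * b_poly * chain_sum w))"
    using tau_t_power(2)[of "rank_diff r y one - 1" 1]
    by (simp add: chain_sum_step[OF top assms] tau_add tau_sum finite_above tau_1)
  also have "(\<Sum>w\<in>?U. tau1 (t_poly ^ (rank_diff r y w - 1) * b_poly * chain_sum w)) =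
      (\<Sum>w\<in>?U. t_poly ^ (rank_diff r y w - 1) * b_poly * tcheb_sum w)"
  proof (rule sum.cong[OF refl])
    fix w assume "w \<in> ?U"
    then have "tcheb_sum w = tau0 (chain_sum w) + 2 * tau1 (chain_sum w)"
      by (auto simp: tcheb_sum_def poset_less_def)
    then show "tau1 (t_poly ^ (rank_diff r y w - 1) * b_poly * chain_sum w) =
       t_poly ^ (rank_diff r y w - 1) * b_poly * tcheb_sum w"
      by (simp add: mult.assoc tau_t_power tau_b) (simp add: algebra_simps mult_2 mult_2_right)
  qed
  \<comment> \<open>As \<open>tcheb_sum one = 1\<close>, the isolated term is the summand for the top element.\<close>
  also have "t_poly ^ (rank_diff r y one - 1) * b_poly + \<dots> =
    (\<Sum>w\<in>insert one ?U. t_poly ^ (rank_diff r y w - 1) * b_poly * tcheb_sum w)"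
    using not_top_less[OF top] by (subst sum.insert) (simp_all add: finite_above tcheb_sum_def)
  also have "insert one ?U = {w. poset_less r y w}"
    using assms by (auto simp: less_Field intro: less_one)
  finally show ?thesis .
qed

text \<open>
  Expanding \<open>tau1 (chain_sum z)\<close> in \<open>tau0 (t ^ (k - 1) * b * chain_sum z) = t ^ k * tau1 (chain_sum z)\<close>
  merges the gaps from \<open>y\<close> to \<open>z\<close> and from \<open>z\<close> to \<open>w\<close> into one, so each \<open>w\<close> is counted once for
  every \<open>z\<close> strictly between \<open>y\<close> and \<open>w\<close>.
\<close>

lemma tau0_chain_sum:
  assumes "poset_less r y one"
  shows "tau0 (chain_sum y) = t_poly ^ rank_diff r y one +
    (\<Sum>w | poset_less r y w. of_nat (card {z. poset_less r y z \<and> poset_less r z w}) *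
       (t_poly ^ (rank_diff r y w - 1) * b_poly * tcheb_sum w))"
proof -
  let ?U = "{z. poset_less r y z \<and> poset_less r z one}"
  have "tau0 (chain_sum y) = t_poly ^ (rank_diff r y one - 1) * t_poly +
      (\<Sum>z\<in>?U. tau0 (t_poly ^ (rank_diff r y z - 1) * b_poly * chain_sum z))"
    using tau_t_power(1)[of "rank_diff r y one - 1" 1]
    by (simp add: chain_sum_step[OF top assms] tau_add tau_sum finite_above tau_1)
  also have "t_poly ^ (rank_diff r y one - 1) * t_poly = t_poly ^ rank_diff r y one"
    using rank_strict[OF assms] by (intro power_minus_mult) (simp add: rank_diff_def)
  also have "(\<Sum>z\<in>?U. tau0 (t_poly ^ (rank_diff r y z - 1) * b_poly * chain_sum z)) =
      (\<Sum>z\<in>?U. \<Sum>w | w \<in> {w. poset_less r y w} \<and> poset_less r z w. t_poly ^ (rank_diff r y w - 1) * b_poly * tcheb_sum w)"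
  proof (rule sum.cong[OF refl])
    fix z assume z: "z \<in> ?U"
    have "tau0 (t_poly ^ (rank_diff r y z - 1) * b_poly * chain_sum z) =
      t_poly ^ (rank_diff r y z - 1) * t_poly * tau1 (chain_sum z)"
      by (simp add: mult.assoc tau_t_power tau_b)
    also have "t_poly ^ (rank_diff r y z - 1) * t_poly = t_poly ^ rank_diff r y z"
      using z rank_strict[of y z] by (intro power_minus_mult) (simp add: rank_diff_def)
    also have "t_poly ^ rank_diff r y z * tau1 (chain_sum z) =
      (\<Sum>w | poset_less r z w. t_poly ^ rank_diff r y z * (t_poly ^ (rank_diff r z w - 1) * b_poly * tcheb_sum w))"
      using z by (simp add: tau1_chain_sum sum_distrib_left)
    also have "\<dots> = (\<Sum>w | w \<in> {w. poset_less r y w} \<and> poset_less r z w. t_poly ^ (rank_diff r y w - 1) * b_poly * tcheb_sum w)"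
    proof (rule sum.cong)
      fix w assume "w \<in> {w. w \<in> {w. poset_less r y w} \<and> poset_less r z w}"
      then have "rank_diff r y w - 1 = rank_diff r y z + (rank_diff r z w - 1)"
        using z rank_strict[of y z] rank_strict[of z w] by (simp add: rank_diff_def)
      then show "t_poly ^ rank_diff r y z * (t_poly ^ (rank_diff r z w - 1) * b_poly * tcheb_sum w) =
        t_poly ^ (rank_diff r y w - 1) * b_poly * tcheb_sum w"
        by (simp add: power_add mult.assoc)
    qed (use z less_trans[of y z] in auto)
    finally show "tau0 (t_poly ^ (rank_diff r y z - 1) * b_poly * chain_sum z) = \<dots>" .
  qed
  also have "\<dots> = (\<Sum>w | poset_less r y w. \<Sum>z | z \<in> ?U \<and> poset_less r z w.
      t_poly ^ (rank_diff r y w - 1) * b_poly * tcheb_sum w)"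
    using finite_above[of y "\<lambda>_. True"] by (intro sum.swap_restrict finite_above) simp
  also have "\<dots> = (\<Sum>w | poset_less r y w. of_nat (card {z. poset_less r y z \<and> poset_less r z w}) *
       (t_poly ^ (rank_diff r y w - 1) * b_poly * tcheb_sum w))"
  proof (rule sum.cong[OF refl])
    fix w assume "w \<in> {w. poset_less r y w}"
    then have "w = one \<or> poset_less r w one"
      using less_one less_Field by blast
    then have "{z. z \<in> ?U \<and> poset_less r z w} = {z. poset_less r y z \<and> poset_less r z w}"
      using less_trans[of _ w one] by auto
    then show "(\<Sum>z | z \<in> ?U \<and> poset_less r z w. t_poly ^ (rank_diff r y w - 1) * b_poly * tcheb_sum w) =
      of_nat (card {z. poset_less r y z \<and> poset_less r z w}) *
       (t_poly ^ (rank_diff r y w - 1) * b_poly * tcheb_sum w)"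
      by simp
  qed
  finally show ?thesis .
qed

text \<open>
  The coefficient is the number of elements of the interval from \<open>y\<close> to \<open>w\<close>: the inner ones come
  from \<open>tau0\<close> and the two ends from \<open>2 tau1\<close>.
\<close>

lemma tcheb_sum_step:
  assumes "poset_less r y one"
  shows "tcheb_sum y = t_poly ^ rank_diff r y one +
    (\<Sum>w | poset_less r y w. of_nat (card {z. poset_less r y z \<and> poset_less r z w} + 2) *
       (t_poly ^ (rank_diff r y w - 1) * b_poly * tcheb_sum w))"
proof -
  have "tcheb_sum y = tau0 (chain_sum y) + 2 * tau1 (chain_sum y)"
    using assms by (auto simp: tcheb_sum_def poset_less_def)
  then show ?thesis
    by (simp add: tau0_chain_sum[OF assms] tau1_chain_sum[OF assms] sum_distrib_left
      add.assoc flip: sum.distrib) (simp add: algebra_simps mult_2)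
qed

interpretation T: finite_poset "tchebyshev r" by (rule finite_poset_tchebyshev)

lemma card_choices:
  assumes "poset_less r y w" "segment x y"
  shows "card (insert x (Some ` {z. (y, z) \<in> r \<and> poset_less r z w})) =
    card {z. poset_less r y z \<and> poset_less r z w} + 2"
proof -
  let ?A = "{z. poset_less r y z \<and> poset_less r z w}"
  have eq: "{z. (y, z) \<in> r \<and> poset_less r z w} = insert y ?A"
    using assms by (auto simp: poset_less_def segment_iff le_refl)
  have "x \<notin> Some ` insert y ?A"
    using assms(2) by (auto simp: segment_iff poset_less_def dest: le_antisym)
  then have "card (insert x (Some ` insert y ?A)) = Suc (card (Some ` insert y ?A))"
    by (intro card_insert_disjoint) (simp_all add: finite_above)
  also have "card (Some ` insert y ?A) = card (insert y ?A)"
    by (intro card_image inj_Some)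
  also have "\<dots> = Suc (card ?A)"
    by (intro card_insert_disjoint finite_above) (simp add: poset_less_def)
  finally show ?thesis unfolding eq by simp
qed

text \<open>
  Both sides satisfy the same recursion, by \<open>card_choices\<close> and \<open>tcheb_sum_step\<close>; the induction runs
  downwards from the top of the poset.
\<close>

lemma chain_sum_tchebyshev:
  assumes "segment x y"
  shows "T.chain_sum (Some (x, Some y)) = tcheb_sum y"
  using assms
proof (induction "poset_rank r - rank_of r y" arbitrary: x y rule: less_induct)
  case less
  let ?u = "Some (x, Some y)"
  let ?Z = "\<lambda>w. insert x (Some ` {z. (y, z) \<in> r \<and> poset_less r z w})"
  let ?S = "SIGMA w:{w. poset_less r y w}. ?Z w"
  let ?e = "\<lambda>(w, z). Some (z, Some w)"
  have y: "y \<in> Field r" using less.prems by (simp add: segment_iff)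
  have rank_le: "rank_of r w \<le> poset_rank r" if "w \<in> Field r" for w
    using rank_mono(1)[OF rank, of w one] that top by (simp add: is_top_def poset_rank_def)
  have seg: "segment z w" if "poset_less r y w" "z \<in> ?Z w" for z w
    using that less.prems segment_trans[of x y w] by (auto simp: segment_iff poset_less_def le_Field)
  have fin: "finite {z. (y, z) \<in> r \<and> poset_less r z w}" for w
    by (rule finite_subset[OF _ finite_Field]) (auto simp: less_Field)
  have in_carrier: "Some (z, Some w) \<in> tcheb_carrier r" if "segment z w" for z w
    using that by (auto simp: tcheb_carrier_eq)
  have "poset_less (tchebyshev r) ?u None" using less.prems by (simp add: tcheb_less_iff)
  then have "T.chain_sum ?u = t_poly ^ (rank_diff (tchebyshev r) ?u None - 1) +
      (\<Sum>v | poset_less (tchebyshev r) ?u v \<and> poset_less (tchebyshev r) v None.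
         t_poly ^ (rank_diff (tchebyshev r) ?u v - 1) * b_poly * T.chain_sum v)"
    by (rule T.chain_sum_step[OF is_top_tchebyshev])
  also have "rank_diff (tchebyshev r) ?u None - 1 = rank_diff r y one"
    using rank_le[OF y] in_carrier[OF less.prems]
    by (simp add: rank_diff_def rank_of_tchebyshev tcheb_carrier_def poset_rank_def)
  also have "{v. poset_less (tchebyshev r) ?u v \<and> poset_less (tchebyshev r) v None} = ?e ` ?S"
  proof -
    have "poset_less (tchebyshev r) (Some (z, Some w)) None" if "segment z w" for z w
      using that by (simp add: tcheb_less_iff)
    moreover have "\<not> poset_less (tchebyshev r) None None" by (simp add: poset_less_def)
    ultimately show ?thesis
      using seg by (fastforce simp: tcheb_less_iff[OF less.prems] image_iff)
  qed
  also have "(\<Sum>v\<in>?e ` ?S. t_poly ^ (rank_diff (tchebyshev r) ?u v - 1) * b_poly * T.chain_sum v) =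
      (\<Sum>s\<in>?S. t_poly ^ (rank_diff (tchebyshev r) ?u (?e s) - 1) * b_poly * T.chain_sum (?e s))"
    by (rule sum.reindex[unfolded o_def]) (auto intro: inj_onI)
  also have "\<dots> = (\<Sum>(w, z)\<in>?S. t_poly ^ (rank_diff r y w - 1) * b_poly * tcheb_sum w)"
  proof (rule sum.cong[OF refl])
    fix s assume "s \<in> ?S"
    then obtain w z where s: "s = (w, z)" "poset_less r y w" "z \<in> ?Z w" by blast
    have "T.chain_sum (Some (z, Some w)) = tcheb_sum w"
      using rank_strict[OF s(2)] rank_le[of w] s(2) seg[OF s(2,3)]
      by (intro less.hyps) (auto simp: less_Field)
    then show "t_poly ^ (rank_diff (tchebyshev r) ?u (?e s) - 1) * b_poly * T.chain_sum (?e s) =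
      (case s of (w, z) \<Rightarrow> t_poly ^ (rank_diff r y w - 1) * b_poly * tcheb_sum w)"
      using in_carrier[OF less.prems] in_carrier[OF seg[OF s(2,3)]]
      by (simp add: s(1) rank_diff_def rank_of_tchebyshev)
  qed
  also have "\<dots> = (\<Sum>w | poset_less r y w. \<Sum>z\<in>?Z w. t_poly ^ (rank_diff r y w - 1) * b_poly * tcheb_sum w)"
    using finite_above[of y "\<lambda>_. True"]
    by (subst sum.Sigma) (simp_all add: fin)
  also have "\<dots> = (\<Sum>w | poset_less r y w. of_nat (card {z. poset_less r y z \<and> poset_less r z w} + 2) *
       (t_poly ^ (rank_diff r y w - 1) * b_poly * tcheb_sum w))"
    using less.prems by (intro sum.cong refl) (simp add: card_choices)
  finally have step: "T.chain_sum ?u = t_poly ^ rank_diff r y one + \<dots>" .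
  show ?case
  proof (cases "y = one")
    case True
    then have "{w. poset_less r y w} = {}"
      using not_top_less[OF top] by simp
    then show ?thesis
      unfolding step by (simp only: sum.empty True) (simp add: rank_diff_def tcheb_sum_def)
  next
    case False
    then show ?thesis
      unfolding step using tcheb_sum_step[OF less_one[OF y]] by simp
  qed
qed

theorem ab_index_tchebyshev:
  assumes "1 \<le> poset_rank r"
  shows "ab_index (tchebyshev r) = tau0 (ab_index r) + 2 * tau1 (ab_index r)"
proof -
  have "rank_of r zero = 0" using rank by (simp add: is_rank_function_def)
  then have "zero \<noteq> one" using assms by (auto simp: poset_rank_def)
  then show ?thesis
    by (simp add: T.ab_index_eq_chain_sum T.poset_bot_eq[OF is_bottom_tchebyshev]
      chain_sum_tchebyshev[OF segment_zero] tcheb_sum_def ab_index_eq_chain_sum)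
qed

end

theorem theorem6p3:
  fixes P :: "'a rel" and \<Phi> :: "cd_var ncpoly"
  assumes "eulerian_poset P"
    and "1 \<le> poset_rank P"
    and "is_cd_index P \<Phi>"
    and "nonneg_coeffs \<Phi>"
  shows "\<exists>\<Psi>. is_cd_index (tchebyshev P) \<Psi> \<and> nonneg_coeffs \<Psi>"
proof -
  have graded: "graded_poset P" using assms(1) by (simp add: eulerian_poset_def)
  interpret finite_poset P
    using graded by unfold_locales (auto simp: graded_poset_def)
  interpret bounded_ranked_poset P
  proof unfold_locales
    show "is_bottom P (poset_bot P)" "is_top P (poset_top P)"
      using graded poset_bot_eq poset_top_eq by (auto simp: graded_poset_def)
    show "is_rank_function P (rank_of P)"
      using graded unfolding rank_of_def graded_poset_def
      by (elim conjE exE) (rule someI[of "is_rank_function P"])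
  qed
  have "cd_eval (tcheb_cd \<Phi>) = ab_index (tchebyshev P)"
    using assms(3) by (simp add: cd_eval_tcheb_cd ab_index_tchebyshev[OF assms(2)] is_cd_index_def)
  then show ?thesis
    using nonneg_coeffs_tcheb_cd[OF assms(4)] by (auto simp: is_cd_index_def)
qed
end
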